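(* Let $t\ge 2$ and let $G$ be a graph with $\chi_{lat}(G)=t$. Let $f$ be a local antimagic total labeling of $G$ that induces exactly $t$ distinct vertex weights, and let $V(G)=\bigcup_{k=1}^{t}V_k$ be the induced partition of $V(G)$ into $t$ independent sets (the classes of vertices of equal weight $w_f$). Suppose that for each $1\le k\le t$ there is an integer $d_k$ with $\deg(x)=d_k$ for every $x\in V_k$, and that $w_f(x)-d_a\neq w_f(y)-d_b$ whenever $x\in V_a$, $y\in V_b$ and $1\le a<b\le t$. Let $e$ be an edge of $G$ with $f(e)=1$ and let $H$ be obtained from $G$ by deleting $e$. Then $\chi(H)\le\chi_{lat}(H)\le t$.
   Context: Graphs are finite and simple; $\chi$ is the usual chromatic number. For a graph $G$ of order $p$ and size $q$, a local antimagic total labeling of $G$ is a bijection $f:V(G)\cup E(G)\to\{1,\ldots,p+q\}$ such that $w_f(u)\neq w_f(v)$ for every edge $uv$ of $G$, where $w_f(u)=f(u)+\sum_{ux\in E(G)}f(ux)$ is the weight of $u$. $\chi_{lat}(G)$ is the minimum number of distinct vertex weights over all local antimagic total labelings of $G$. *)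

theory Defs
  imports Main
begin

definition simple_graph :: "'a set \<Rightarrow> 'a set set \<Rightarrow> bool" where
  "simple_graph V E \<longleftrightarrow> finite V \<and> (\<forall>e\<in>E. e \<subseteq> V \<and> card e = 2)"

definition neighbours :: "'a set set \<Rightarrow> 'a \<Rightarrow> 'a set" where
  "neighbours E u = {x. {u, x} \<in> E}"

definition degree :: "'a set set \<Rightarrow> 'a \<Rightarrow> nat" where
  "degree E u = card (neighbours E u)"

definition proper_colouring :: "'a set \<Rightarrow> 'a set set \<Rightarrow> nat \<Rightarrow> ('a \<Rightarrow> nat) \<Rightarrow> bool" where
  "proper_colouring V E k c \<longleftrightarrow>
     c ` V \<subseteq> {..<k} \<and> (\<forall>u v. {u, v} \<in> E \<longrightarrow> c u \<noteq> c v)"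

definition chromatic_number :: "'a set \<Rightarrow> 'a set set \<Rightarrow> nat" where
  "chromatic_number V E = (LEAST k. \<exists>c. proper_colouring V E k c)"

text \<open>
  A total labeling is a function on the disjoint sum of vertices and edges:
  \<open>f (Inl u)\<close> is the label of the vertex \<open>u\<close> and \<open>f (Inr e)\<close> that of the edge \<open>e\<close>.
\<close>

definition weight :: "'a set set \<Rightarrow> ('a + 'a set \<Rightarrow> nat) \<Rightarrow> 'a \<Rightarrow> nat" where
  "weight E f u = f (Inl u) + (\<Sum>x\<in>neighbours E u. f (Inr {u, x}))"

definition local_antimagic_total ::
    "'a set \<Rightarrow> 'a set set \<Rightarrow> ('a + 'a set \<Rightarrow> nat) \<Rightarrow> bool" where
  "local_antimagic_total V E f \<longleftrightarrow>
     bij_betw f (V <+> E) {1..card V + card E} \<and>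
     (\<forall>u v. {u, v} \<in> E \<longrightarrow> weight E f u \<noteq> weight E f v)"

text \<open>
  If there is no local antimagic total labeling, the value below is unspecified.
\<close>

definition chi_lat :: "'a set \<Rightarrow> 'a set set \<Rightarrow> nat" where
  "chi_lat V E =
     (LEAST n. \<exists>f. local_antimagic_total V E f \<and> card (weight E f ` V) = n)"

definition weight_classes ::
    "'a set \<Rightarrow> 'a set set \<Rightarrow> ('a + 'a set \<Rightarrow> nat) \<Rightarrow> 'a set set" where
  "weight_classes V E f =
     V // {(x, y). x \<in> V \<and> y \<in> V \<and> weight E f x = weight E f y}"

end

theory Submission
  imports Defs
begin

text \<open>
  Subtract \<open>1\<close> from every label. The edge \<open>e\<close>, which carries the label \<open>1\<close>, then has label \<open>0\<close>.
  Deleting \<open>e\<close> removes just the value \<open>0\<close>, so the remaining labels are exactly those prescribed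
  for \<open>H\<close>; and as \<open>e\<close> contributes \<open>0\<close> to the weights of its ends, the deletion changes no
  weight. Hence at each vertex \<open>u\<close>, the ends of \<open>e\<close> included, the new weight is
  \<open>w\<^sub>f(u) - 1 - deg u\<close> with the degree taken in \<open>G\<close> (lemma \<open>weight_shifted_delete_edge\<close>).

  Vertices of equal \<open>w\<^sub>f\<close> have equal degree, so the new weight is a function of the old one and
  at most \<open>t\<close> values occur. Adjacent vertices lie in different classes, where
  \<open>w\<^sub>f - deg\<close> differs by assumption, so the shifted labeling is local antimagic total and
  \<open>chi_lat\<close> of \<open>H\<close> is at most \<open>t\<close>.

  The lower bound on \<open>chi_lat\<close> holds for every graph that has a local antimagic total labeling:
  the weights of an optimal one form a proper colouring.
\<close>

lemma chi_lat_le: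
  assumes "local_antimagic_total V E f"
  shows "chi_lat V E \<le> card (weight E f ` V)"
  unfolding chi_lat_def using assms by (auto intro: Least_le)

lemma chi_lat_attained:
  assumes "local_antimagic_total V E f"
  obtains g where "local_antimagic_total V E g" "card (weight E g ` V) = chi_lat V E"
proof -
  have "\<exists>n g. local_antimagic_total V E g \<and> card (weight E g ` V) = n"
    using assms by blast
  then have "\<exists>g. local_antimagic_total V E g \<and> card (weight E g ` V) = chi_lat V E"
    unfolding chi_lat_def by (rule LeastI_ex)
  then show ?thesis using that by blast
qed

text \<open>
  The weights need only be renumbered to become colours below \<open>chi_lat V E\<close>. The existence of
  some labeling matters: without it \<open>chi_lat V E\<close> is an unspecified number.
\<close>

lemma chromatic_number_le_chi_lat:
  assumes G: "simple_graph V E" and "local_antimagic_total V E f"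
  shows "chromatic_number V E \<le> chi_lat V E"
proof -
  obtain g where g: "local_antimagic_total V E g" and card: "card (weight E g ` V) = chi_lat V E"
    using assms(2) by (rule chi_lat_attained)
  have "finite (weight E g ` V)" using G by (simp add: simple_graph_def)
  then obtain r where r: "bij_betw r (weight E g ` V) {0..<chi_lat V E}"
    using ex_bij_betw_finite_nat card by metis
  have "proper_colouring V E (chi_lat V E) (r \<circ> weight E g)"
    unfolding proper_colouring_def
  proof (intro conjI allI impI)
    show "(r \<circ> weight E g) ` V \<subseteq> {..<chi_lat V E}"
      using r by (auto simp: bij_betw_def image_comp [symmetric])
  next
    fix u v assume uv: "{u, v} \<in> E"
    then have "u \<in> V" "v \<in> V" using G by (auto simp: simple_graph_def)
    moreover have "weight E g u \<noteq> weight E g v"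
      using g uv by (simp add: local_antimagic_total_def)
    ultimately show "(r \<circ> weight E g) u \<noteq> (r \<circ> weight E g) v"
      using bij_betw_imp_inj_on [OF r] by (auto dest: inj_onD)
  qed
  then show ?thesis unfolding chromatic_number_def by (auto intro: Least_le)
qed

lemma finite_edges:
  assumes "simple_graph V E"
  shows "finite E"
proof (rule finite_subset)
  show "E \<subseteq> Pow V" using assms by (auto simp: simple_graph_def)
  show "finite (Pow V)" using assms by (simp add: simple_graph_def)
qed

lemma finite_neighbours:
  assumes "simple_graph V E"
  shows "finite (neighbours E u)"
proof (rule finite_subset)
  show "neighbours E u \<subseteq> V" using assms by (auto simp: simple_graph_def neighbours_def)
  show "finite V" using assms by (simp add: simple_graph_def)
qed

text \<open>
  In \<open>G\<close> every edge at \<open>u\<close> loses \<open>1\<close>, hence the term \<open>degree E u\<close>; restricting the sum to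
  the edges of \<open>H\<close> costs nothing, since the only edge that can be lost has shifted label \<open>0\<close>.
  The equation is written additively because the shift uses truncated subtraction, which is
  harmless as labels are positive.
\<close>

lemma weight_shifted_delete_edge:
  assumes G: "simple_graph V E" and pos: "\<And>z. z \<in> V <+> E \<Longrightarrow> 1 \<le> f z"
    and e1: "f (Inr e) = 1" and u: "u \<in> V"
  shows "weight (E - {e}) (\<lambda>z. f z - 1) u + degree E u + 1 = weight E f u"
proof -
  let ?N = "neighbours E u"
  note fin = finite_neighbours [OF G, of u]
  have "(\<Sum>x\<in>neighbours (E - {e}) u. f (Inr {u, x}) - 1) = (\<Sum>x\<in>?N. f (Inr {u, x}) - 1)"
    by (rule sum.mono_neutral_left [OF fin]) (use e1 in \<open>auto simp: neighbours_def\<close>)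
  moreover have "(\<Sum>x\<in>?N. f (Inr {u, x}) - 1) + card ?N = (\<Sum>x\<in>?N. f (Inr {u, x}))"
  proof -
    have "(\<Sum>x\<in>?N. f (Inr {u, x}) - 1) + card ?N = (\<Sum>x\<in>?N. (f (Inr {u, x}) - 1) + 1)"
      by (simp only: sum.distrib card_eq_sum)
    also have "\<dots> = (\<Sum>x\<in>?N. f (Inr {u, x}))"
    proof (rule sum.cong [OF refl])
      fix x assume "x \<in> ?N"
      then have "1 \<le> f (Inr {u, x})" using pos by (simp add: neighbours_def InrI)
      then show "f (Inr {u, x}) - 1 + 1 = f (Inr {u, x})" by simp
    qed
    finally show ?thesis .
  qed
  moreover have "1 \<le> f (Inl u)" using pos u by blast
  ultimately show ?thesis unfolding weight_def degree_def by simp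
qed

lemma bij_betw_shifted_delete_edge:
  assumes G: "simple_graph V E" and f: "bij_betw f (V <+> E) {1..card V + card E}"
    and e: "e \<in> E" and e1: "f (Inr e) = 1"
  shows "bij_betw (\<lambda>z. f z - 1) (V <+> (E - {e})) {1..card V + card (E - {e})}"
proof -
  let ?n = "card V + card E"
  have n: "card V + card (E - {e}) = ?n - 1"
    using e card_gt_0_iff [of E] finite_edges [OF G] by auto
  have "V <+> (E - {e}) = (V <+> E) - {Inr e}" by auto
  moreover have "{1..?n} - {1} = {2..?n}" by auto
  moreover have "bij_betw f ((V <+> E) - {Inr e}) ({1..?n} - {1})"
  proof (rule bij_betw_DiffI [OF f])
    show "bij_betw f {Inr e} {1}" using e1 by (simp add: bij_betw_def)
    show "{Inr e} \<subseteq> V <+> E" using e by auto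
    show "{1} \<subseteq> {1..?n}" using bij_betwE [OF f] e e1 by fastforce
  qed
  ultimately have "bij_betw f (V <+> (E - {e})) {2..?n}" by (simp only:)
  moreover have "bij_betw (\<lambda>k. k - 1) {2..?n} {1..?n - 1}"
    by (rule bij_betw_byWitness [where f' = Suc]) auto
  ultimately have "bij_betw ((\<lambda>k. k - 1) \<circ> f) (V <+> (E - {e})) {1..?n - 1}"
    by (rule bij_betw_trans)
  then show ?thesis by (simp only: n comp_def)
qed

theorem lemma2p13:
  fixes V :: "'a set" and E :: "'a set set"
    and f :: "'a + 'a set \<Rightarrow> nat" and t :: nat
    and P :: "nat \<Rightarrow> 'a set" and d :: "nat \<Rightarrow> int" and e :: "'a set"
  assumes "t \<ge> 2"
    and "simple_graph V E"
    and "chi_lat V E = t"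
    and "local_antimagic_total V E f"
    and "card (weight E f ` V) = t"
    and "bij_betw P {1..t} (weight_classes V E f)"
    and "\<And>k x. k \<in> {1..t} \<Longrightarrow> x \<in> P k \<Longrightarrow> int (degree E x) = d k"
    and "\<And>a b x y. 1 \<le> a \<Longrightarrow> a < b \<Longrightarrow> b \<le> t \<Longrightarrow> x \<in> P a \<Longrightarrow> y \<in> P b \<Longrightarrow>
           int (weight E f x) - d a \<noteq> int (weight E f y) - d b"
    and "e \<in> E"
    and "f (Inr e) = 1"
  shows "chromatic_number V (E - {e}) \<le> chi_lat V (E - {e}) \<and> chi_lat V (E - {e}) \<le> t"
proof -
  note G = assms(2) and deg = assms(7) and sep = assms(8)
  define H where "H = E - {e}"
  define g where "g = (\<lambda>z. f z - 1)"
  have f: "bij_betw f (V <+> E) {1..card V + card E}"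
    and proper: "\<And>u v. {u, v} \<in> E \<Longrightarrow> weight E f u \<noteq> weight E f v"
    using assms(4) by (auto simp: local_antimagic_total_def)
  have pos: "1 \<le> f z" if "z \<in> V <+> E" for z
    using bij_betwE [OF f] that by auto
  have shift: "weight H g u + degree E u + 1 = weight E f u" if "u \<in> V" for u
    unfolding H_def g_def using weight_shifted_delete_edge [where f = f, OF G pos assms(10) that] .

  have P: "P ` {1..t} = weight_classes V E f"
    using assms(6) by (rule bij_betw_imp_surj_on)
  have class_ex: "\<exists>k\<in>{1..t}. P k = {y \<in> V. weight E f x = weight E f y}" if "x \<in> V" for x
  proof -
    have "{y \<in> V. weight E f x = weight E f y} \<in> weight_classes V E f"
      unfolding weight_classes_def quotient_def using that by auto
    then show ?thesis unfolding P [symmetric] by blast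
  qed

  have same: "weight H g x = weight H g y"
    if "x \<in> V" "y \<in> V" "weight E f x = weight E f y" for x y
  proof -
    obtain k where k: "k \<in> {1..t}" "P k = {z \<in> V. weight E f x = weight E f z}"
      using class_ex [OF \<open>x \<in> V\<close>] by blast
    then have "x \<in> P k" "y \<in> P k" using that by simp_all
    then have "degree E x = degree E y" using deg k(1) by (metis of_nat_eq_iff)
    then show ?thesis using shift [OF that(1)] shift [OF that(2)] that(3) by simp
  qed
  have distinct: "weight H g x \<noteq> weight H g y"
    if "x \<in> V" "y \<in> V" "weight E f x \<noteq> weight E f y" for x y
  proof -
    obtain a where a: "a \<in> {1..t}" "P a = {z \<in> V. weight E f x = weight E f z}"
      using class_ex [OF \<open>x \<in> V\<close>] by blast
    obtain b where b: "b \<in> {1..t}" "P b = {z \<in> V. weight E f y = weight E f z}"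
      using class_ex [OF \<open>y \<in> V\<close>] by blast
    have x: "x \<in> P a" and y: "y \<in> P b" using that a b by simp_all
    have "y \<notin> P a" using that a by simp
    then have "a \<noteq> b" using y by auto
    then have "int (weight E f x) - d a \<noteq> int (weight E f y) - d b"
      using sep [of a b x y] sep [of b a y x] a(1) b(1) x y
      by (metis atLeastAtMost_iff linorder_neqE_nat)
    then show ?thesis
      using shift [OF that(1)] shift [OF that(2)] deg [OF a(1) x] deg [OF b(1) y] by linarith
  qed

  have g: "local_antimagic_total V H g"
    unfolding local_antimagic_total_def
  proof (intro conjI allI impI)
    show "bij_betw g (V <+> H) {1..card V + card H}"
      unfolding H_def g_def using bij_betw_shifted_delete_edge [OF G f assms(9,10)] .
  next
    fix u v assume "{u, v} \<in> H"
    then have uv: "{u, v} \<in> E" by (simp add: H_def)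
    then have "u \<in> V" "v \<in> V" using G by (auto simp: simple_graph_def)
    then show "weight H g u \<noteq> weight H g v" using distinct proper [OF uv] by blast
  qed

  have "card (weight H g ` V) \<le> card (weight E f ` V)"
  proof (rule surj_card_le)
    show "finite (weight E f ` V)" using G by (simp add: simple_graph_def)
    \<comment> \<open>The new weight factors through the old one: evaluate it at any vertex of that old weight.\<close>
    show "weight H g ` V \<subseteq> (\<lambda>w. weight H g (inv_into V (weight E f) w)) ` (weight E f ` V)"
    proof
      fix w assume "w \<in> weight H g ` V"
      then obtain x where x: "x \<in> V" "w = weight H g x" by blast
      let ?y = "inv_into V (weight E f) (weight E f x)"
      have "?y \<in> V" using x(1) by (intro inv_into_into imageI)
      moreover have "weight E f ?y = weight E f x" using x(1) by (intro f_inv_into_f imageI)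
      ultimately have "w = weight H g ?y" using same [OF x(1)] x(2) by simp
      then show "w \<in> (\<lambda>w. weight H g (inv_into V (weight E f) w)) ` (weight E f ` V)"
        using x(1) by blast
    qed
  qed
  then have "chi_lat V H \<le> t" using chi_lat_le [OF g] assms(5) by linarith
  moreover have "simple_graph V H" using G by (auto simp: simple_graph_def H_def)
  then have "chromatic_number V H \<le> chi_lat V H" using g by (rule chromatic_number_le_chi_lat)
  ultimately show ?thesis by (simp add: H_def)
qed

end
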